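(* Let $(X,d)$ be a complete metric space, let $\kappa$ be an $e^{0}$-distance on $X$, let $T:X\to\mathcal{C}(X)$ be a multivalued mapping, let $\varphi:X\to X$ be a continuous self-mapping, let $\mu:[0,\infty)\to[0,1)$ be an $\mathcal{MT}$-function, and let $L\geq0$. Suppose that: (S2) $T$ satisfies one of the following conditions: (H1) $T$ is closed; (H2) the function $f:X\to[0,\infty)$ defined by $f(x)=\kappa(x,Tx)$ is lower semicontinuous; (H3) the function $g:X\to[0,\infty)$ defined by $g(x)=d(x,Tx)$ is lower semicontinuous; (H4) for any sequence $\{x_n\}$ in $X$ with $x_{n+1}\in Tx_n$ for all $n\in\mathbb{N}$ and $\lim_{n\to\infty}x_n=v$, we have $\lim_{n\to\infty}\kappa(x_n,Tv)=0$; (H5) $\inf\{\kappa(x,z)+\kappa(x,Tx):x\in X\}>0$ for every $z\in X$ with $z\notin\mathcal{F}(T)$; and further that (S4) $Tx$ is $\varphi$-invariant (i.e. $\varphi(Tx)\subseteq Tx$) for each $x\in X$; (S5) $\kappa(y,Ty)\leq\mu(\kappa(x,y))\,\kappa(x,y)+L\,\kappa(\varphi y,Tx)$ for all $x,y\in X$. Then $\mathcal{COP}(\varphi,T)\cap\mathcal{F}(T)\neq\emptyset$.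
   Context: For a metric space $(X,d)$, $\mathcal{C}(X)$ denotes the class of all nonempty closed subsets of $X$. For a multivalued mapping $T$ on $X$, $\mathcal{F}(T)=\{v\in X: v\in Tv\}$ is its set of fixed points, and $T$ is closed if its graph $\{(x,y)\in X\times X:y\in Tx\}$ is closed in $X\times X$. For $\varphi:X\to X$, $\mathcal{COP}(\varphi,T)=\{x\in X:\varphi x\in Tx\}$ is the set of coincidence points of $\varphi$ and $T$. A function $\kappa:X\times X\to[0,+\infty)$ is an $e$-distance (essential distance) on $(X,d)$ if: ($\tau1$) $\kappa(x,z)\leq\kappa(x,y)+\kappa(y,z)$ for all $x,y,z\in X$; ($\tau2$) if $x\in X$ and $\{y_n\}$ is a sequence in $X$ with $\lim_{n\to\infty}y_n=y$ such that $\kappa(x,y_n)\leq M$ for all $n$, for some $M=M(x)>0$, then $\kappa(x,y)\leq M$; ($\tau3$) for any sequence $\{x_n\}$ in $X$ with $\lim_{n\to\infty}\sup\{\kappa(x_n,x_m):m>n\}=0$, if there exists a sequence $\{y_n\}$ in $X$ such that $\lim_{n\to\infty}\kappa(x_n,y_n)=0$, then $\lim_{n\to\infty}d(x_n,y_n)=0$. Limits of sequences in $X$, continuity and lower semicontinuity are with respect to $d$; $\kappa$ is not assumed symmetric. An $e^{0}$-distance is an $e$-distance $\kappa$ with $\kappa(x,x)=0$ for all $x\in X$. For $x\in X$ and nonempty $C\subseteq X$, $\kappa(x,C)=\inf_{y\in C}\kappa(x,y)$ and $d(x,C)=\inf_{y\in C}d(x,y)$. A function $\mu:[0,\infty)\to[0,1)$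 is an $\mathcal{MT}$-function if $\limsup_{s\to t^{+}}\mu(s)<1$ for all $t\in[0,\infty)$. *)

theory Defs
  imports "HOL-Analysis.Analysis"
begin

text \<open>The metric space \<open>(X, d)\<close> is a type \<open>'a\<close> of class \<open>metric_space\<close> with \<open>d = dist\<close>.\<close>

definition nonempty_closed_sets :: "'a::metric_space set set" where
  "nonempty_closed_sets = {C. C \<noteq> {} \<and> closed C}"

definition fixed_point_set :: "('a \<Rightarrow> 'a set) \<Rightarrow> 'a set" where
  "fixed_point_set T = {v. v \<in> T v}"

definition coincidence_set :: "('a \<Rightarrow> 'a) \<Rightarrow> ('a \<Rightarrow> 'a set) \<Rightarrow> 'a set" where
  "coincidence_set \<phi> T = {x. \<phi> x \<in> T x}"

definition closed_multimap :: "('a::metric_space \<Rightarrow> 'a set) \<Rightarrow> bool" where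
  "closed_multimap T \<longleftrightarrow> closed {(x, y). y \<in> T x}"

text \<open>In the third condition the suprema are taken in \<^typ>\<open>ereal\<close>, since
  \<open>{\<kappa> (x n) (x m) | m. m > n}\<close> may be unbounded.\<close>

definition e_distance :: "('a::metric_space \<Rightarrow> 'a \<Rightarrow> real) \<Rightarrow> bool" where
  "e_distance \<kappa> \<longleftrightarrow>
     (\<forall>x y. 0 \<le> \<kappa> x y) \<and>
     (\<forall>x y z. \<kappa> x z \<le> \<kappa> x y + \<kappa> y z) \<and>
     (\<forall>x y. \<forall>ys :: nat \<Rightarrow> 'a. \<forall>M > 0.
        ys \<longlonglongrightarrow> y \<longrightarrow> (\<forall>n. \<kappa> x (ys n) \<le> M) \<longrightarrow> \<kappa> x y \<le> M) \<and>
     (\<forall>xs ys :: nat \<Rightarrow> 'a.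
        (\<lambda>n. SUP m\<in>{n<..}. ereal (\<kappa> (xs n) (xs m))) \<longlonglongrightarrow> 0 \<longrightarrow>
        (\<lambda>n. \<kappa> (xs n) (ys n)) \<longlonglongrightarrow> 0 \<longrightarrow>
        (\<lambda>n. dist (xs n) (ys n)) \<longlonglongrightarrow> 0)"

definition e0_distance :: "('a::metric_space \<Rightarrow> 'a \<Rightarrow> real) \<Rightarrow> bool" where
  "e0_distance \<kappa> \<longleftrightarrow> e_distance \<kappa> \<and> (\<forall>x. \<kappa> x x = 0)"

text \<open>\<open>\<kappa>(x, C)\<close>, meaningful for nonempty \<open>C\<close>; the case \<open>\<kappa> = dist\<close> is \<^const>\<open>infdist\<close>.\<close>

definition set_gap :: "('a \<Rightarrow> 'a \<Rightarrow> real) \<Rightarrow> 'a \<Rightarrow> 'a set \<Rightarrow> real" where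
  "set_gap \<kappa> x C = (INF y\<in>C. \<kappa> x y)"

definition lower_semicontinuous :: "('a::topological_space \<Rightarrow> real) \<Rightarrow> bool" where
  "lower_semicontinuous f \<longleftrightarrow> (\<forall>x. ereal (f x) \<le> Liminf (at x) (\<lambda>y. ereal (f y)))"

text \<open>Only the values of \<open>\<mu>\<close> on \<open>[0, \<infinity>)\<close> matter; \<open>at_right t\<close> excludes \<open>t\<close> itself.\<close>

definition MT_function :: "(real \<Rightarrow> real) \<Rightarrow> bool" where
  "MT_function \<mu> \<longleftrightarrow>
     (\<forall>t\<ge>0. 0 \<le> \<mu> t \<and> \<mu> t < 1) \<and>
     (\<forall>t\<ge>0. Limsup (at_right t) (\<lambda>s. ereal (\<mu> s)) < 1)"

end

theory Submission
  imports Defs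
begin

text \<open>
  The fixed point is the limit of a Picard orbit \<open>x (n + 1) \<in> T (x n)\<close>. If \<open>y \<in> T x\<close>, then
  \<open>\<phi> y \<in> T x\<close> by invariance, so \<open>\<kappa>(\<phi> y, T x) = 0\<close> because \<open>\<kappa>\<close> vanishes on the diagonal. Along an
  orbit the term with the factor \<open>L\<close> therefore disappears, and the hypothesis reduces to
  \<open>\<kappa>(y, T y) \<le> \<mu>(\<kappa>(x, y)) \<kappa>(x, y)\<close>. Replacing the factor \<open>\<mu>\<close> by \<open>(1 + \<mu>)/2\<close> leaves enough room
  to choose an actual next point \<open>z \<in> T y\<close>, with
  \<open>\<kappa>(y, z) \<le> (1 + \<mu>(\<kappa>(x, y)))/2 * \<kappa>(x, y)\<close>.

  The step lengths \<open>\<kappa>(x n, x (n + 1))\<close> then decrease to some \<open>r\<close>. The function \<open>\<mu>\<close> is bounded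
  away from 1 at \<open>r\<close> and immediately to the right of it, so the step lengths eventually decay
  geometrically and are summable (\<open>MT_steps_summable\<close>). The third axiom of an essential distance
  turns this into the Cauchy property for the metric, and the second axiom gives
  \<open>\<kappa>(x n, v) \<longlonglongrightarrow> 0\<close> for the limit \<open>v\<close> (\<open>e_distance_summable_steps\<close>).

  Each of the five alternative regularity conditions then forces \<open>v \<in> T v\<close>. The link is that a
  vanishing gap \<open>\<kappa>(v, T v) = 0\<close> means \<open>v \<in> T v\<close> when \<open>T v\<close> is closed (\<open>set_gap_zero_imp_mem\<close>).
  Invariance of \<open>T v\<close> finally gives \<open>\<phi> v \<in> T v\<close>, so \<open>v\<close> is also a coincidence point.
\<close>

section \<open>Gaps between points and sets\<close>

lemma set_gap_lower:
  assumes "\<And>x y. 0 \<le> \<kappa> x y" "y \<in> C"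
  shows "set_gap \<kappa> x C \<le> \<kappa> x y"
  unfolding set_gap_def using assms by (intro cINF_lower) (auto intro!: bdd_belowI[where m = 0])

lemma set_gap_nonneg:
  assumes "\<And>x y. 0 \<le> \<kappa> x y" "C \<noteq> {}"
  shows "0 \<le> set_gap \<kappa> x C"
  unfolding set_gap_def using assms by (intro cINF_greatest) auto

lemma set_gap_lessD:
  assumes "C \<noteq> {}" "set_gap \<kappa> x C < r"
  obtains y where "y \<in> C" "\<kappa> x y < r"
proof -
  have "\<exists>a\<in>\<kappa> x ` C. a < r"
    using assms unfolding set_gap_def by (intro cInf_lessD) auto
  then show ?thesis using that by blast
qed

section \<open>Essential distances\<close>

lemma e_distance_nonneg: "e_distance \<kappa> \<Longrightarrow> 0 \<le> \<kappa> x y"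
  unfolding e_distance_def by blast

lemma e_distance_triangle: "e_distance \<kappa> \<Longrightarrow> \<kappa> x z \<le> \<kappa> x y + \<kappa> y z"
  unfolding e_distance_def by blast

text \<open>The bound \<open>M\<close> may be \<open>0\<close> here, since every \<open>M + e\<close> with \<open>e > 0\<close> is an admissible bound in
  the axiom; and only a tail of the sequence has to satisfy it.\<close>

lemma e_distance_limit_le:
  assumes "e_distance \<kappa>" "ys \<longlonglongrightarrow> y" "0 \<le> M" "\<And>m. m > n \<Longrightarrow> \<kappa> x (ys m) \<le> M"
  shows "\<kappa> x y \<le> M"
proof (rule field_le_epsilon)
  fix e :: real assume "0 < e"
  have "(\<lambda>m. ys (m + Suc n)) \<longlonglongrightarrow> y"
    using assms(2) by (rule LIMSEQ_ignore_initial_segment)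
  moreover have "\<kappa> x (ys (m + Suc n)) \<le> M + e" for m
    using assms(4)[of "m + Suc n"] \<open>0 < e\<close> by simp
  moreover have "0 < M + e" using assms(3) \<open>0 < e\<close> by simp
  ultimately show "\<kappa> x y \<le> M + e"
    using assms(1) unfolding e_distance_def by blast
qed

text \<open>A form of the third axiom that avoids suprema: a null sequence dominating the tails makes
  them finite and squeezes them to \<open>0\<close>.\<close>

lemma e_distance_dominated_tails:
  assumes "e_distance \<kappa>" "b \<longlonglongrightarrow> 0" "\<And>n m. n < m \<Longrightarrow> \<kappa> (xs n) (xs m) \<le> b n"
    and "(\<lambda>n. \<kappa> (xs n) (ys n)) \<longlonglongrightarrow> 0"
  shows "(\<lambda>n. dist (xs n) (ys n)) \<longlonglongrightarrow> 0"
proof -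
  have "(\<lambda>n. SUP m\<in>{n<..}. ereal (\<kappa> (xs n) (xs m))) \<longlonglongrightarrow> 0"
  proof (rule tendsto_sandwich[of "\<lambda>_. 0" _ _ "\<lambda>n. ereal (b n)"])
    show "\<forall>\<^sub>F n in sequentially. 0 \<le> (SUP m\<in>{n<..}. ereal (\<kappa> (xs n) (xs m)))"
    proof (intro always_eventually allI)
      fix n
      show "0 \<le> (SUP m\<in>{n<..}. ereal (\<kappa> (xs n) (xs m)))"
        by (rule SUP_upper2[of "Suc n"]) (auto simp: e_distance_nonneg[OF assms(1)])
    qed
    show "\<forall>\<^sub>F n in sequentially. (SUP m\<in>{n<..}. ereal (\<kappa> (xs n) (xs m))) \<le> ereal (b n)"
      using assms(3) by (intro always_eventually allI SUP_least) auto
    show "(\<lambda>n. ereal (b n)) \<longlonglongrightarrow> 0"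
      using tendsto_ereal[OF assms(2)] by (simp add: zero_ereal_def)
  qed simp
  then show ?thesis using assms(1,4) unfolding e_distance_def by blast
qed

text \<open>The third axiom lets points of \<open>C\<close> that approach \<open>x n\<close> in \<open>\<kappa>\<close> also approach it in the
  metric.\<close>

lemma limit_mem_of_vanishing_gaps:
  assumes "e_distance \<kappa>" "C \<noteq> {}" "closed C" "x \<longlonglongrightarrow> v"
    and "b \<longlonglongrightarrow> 0" "\<And>n m. n < m \<Longrightarrow> \<kappa> (x n) (x m) \<le> b n"
    and gap: "(\<lambda>n. set_gap \<kappa> (x n) C) \<longlonglongrightarrow> 0"
  shows "v \<in> C"
proof -
  have "\<exists>y\<in>C. \<kappa> (x n) y < set_gap \<kappa> (x n) C + inverse (real (Suc n))" for n
    by (rule set_gap_lessD[OF assms(2), of \<kappa> "x n"]) auto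
  then obtain y where y: "\<And>n. y n \<in> C"
      "\<And>n. \<kappa> (x n) (y n) < set_gap \<kappa> (x n) C + inverse (real (Suc n))"
    by metis
  have "(\<lambda>n. \<kappa> (x n) (y n)) \<longlonglongrightarrow> 0"
  proof (rule tendsto_sandwich[OF _ _ tendsto_const])
    show "(\<lambda>n. set_gap \<kappa> (x n) C + inverse (real (Suc n))) \<longlonglongrightarrow> 0"
      using tendsto_add[OF gap LIMSEQ_inverse_real_of_nat] by simp
    show "\<forall>\<^sub>F n in sequentially. \<kappa> (x n) (y n) \<le> set_gap \<kappa> (x n) C + inverse (real (Suc n))"
      using y(2) by (intro always_eventually allI less_imp_le)
    show "\<forall>\<^sub>F n in sequentially. 0 \<le> \<kappa> (x n) (y n)"
      by (simp add: e_distance_nonneg[OF assms(1)])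
  qed
  then have "(\<lambda>n. dist (x n) (y n)) \<longlonglongrightarrow> 0"
    using e_distance_dominated_tails assms(1,5,6) by blast
  moreover have "(\<lambda>n. dist (x n) v) \<longlonglongrightarrow> 0"
    using assms(4) tendsto_dist_iff by blast
  ultimately have near: "(\<lambda>n. dist (x n) (y n) + dist (x n) v) \<longlonglongrightarrow> 0"
    by (rule tendsto_add_zero)
  have "(\<lambda>n. dist (y n) v) \<longlonglongrightarrow> 0"
    by (rule tendsto_sandwich[OF _ _ tendsto_const near])
       (intro always_eventually allI zero_le_dist dist_triangle3)+
  then have "y \<longlonglongrightarrow> v" using tendsto_dist_iff by blast
  then show ?thesis using y(1) assms(3) closed_sequentially by blast
qed

text \<open>The special case of a constant sequence, whose tails vanish because \<open>\<kappa> x x = 0\<close>.\<close>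

lemma set_gap_zero_imp_mem:
  assumes "e0_distance \<kappa>" "C \<noteq> {}" "closed C" "set_gap \<kappa> x C = 0"
  shows "x \<in> C"
  using assms limit_mem_of_vanishing_gaps[of \<kappa> C "\<lambda>_. x" x "\<lambda>_. 0"]
  unfolding e0_distance_def by simp

section \<open>Orbits with summable steps\<close>

lemma e_distance_le_sum_steps:
  assumes "e_distance \<kappa>" "n < m"
  shows "\<kappa> (x n) (x m) \<le> (\<Sum>k=n..<m. \<kappa> (x k) (x (Suc k)))"
  using assms(2)
proof (induction m)
  case (Suc m)
  show ?case
  proof (cases "n = m")
    case False
    then show ?thesis
      using Suc e_distance_triangle[OF assms(1), of "x n" "x (Suc m)" "x m"] by simp
  qed simp
qed simp

text \<open>The witness \<open>b\<close> is the sequence of tails of the series of step lengths.\<close>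

lemma e_distance_summable_steps:
  fixes \<kappa> :: "'a::complete_space \<Rightarrow> 'a \<Rightarrow> real"
  assumes e: "e_distance \<kappa>" and sum: "summable (\<lambda>n. \<kappa> (x n) (x (Suc n)))"
  obtains v b where "x \<longlonglongrightarrow> v" "b \<longlonglongrightarrow> 0" "\<And>n m. n < m \<Longrightarrow> \<kappa> (x n) (x m) \<le> b n"
    "(\<lambda>n. \<kappa> (x n) v) \<longlonglongrightarrow> 0"
proof -
  define t where "t = (\<lambda>n. \<kappa> (x n) (x (Suc n)))"
  define b where "b = (\<lambda>n. suminf t - (\<Sum>k<n. t k))"
  have sum_t: "summable t" using sum by (simp add: t_def)
  have t0: "0 \<le> t k" for k by (simp add: t_def e_distance_nonneg[OF e])
  have b_lim: "b \<longlonglongrightarrow> 0"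
    unfolding b_def
    using tendsto_diff[OF tendsto_const[of "suminf t"] summable_LIMSEQ[OF sum_t]] by simp
  have b_bound: "\<kappa> (x n) (x m) \<le> b n" if "n < m" for n m
  proof -
    have "\<kappa> (x n) (x m) \<le> sum t {n..<m}"
      using e_distance_le_sum_steps[OF e that, of x] by (simp add: t_def)
    also have "\<dots> = sum t {..<m} - sum t {..<n}"
      using that by (simp add: lessThan_atLeast0 sum_diff_nat_ivl)
    also have "\<dots> \<le> b n"
      unfolding b_def using sum_le_suminf[OF sum_t, of "{..<m}"] t0 by simp
    finally show ?thesis .
  qed
  have b0: "0 \<le> b n" for n
    using b_bound[of n "Suc n"] e_distance_nonneg[OF e, of "x n" "x (Suc n)"] by simp
  have "Cauchy x"
  proof (rule ccontr)
    \<comment> \<open>A failure of the Cauchy property yields indices \<open>f n > n\<close> with \<open>x (f n)\<close> metrically far from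
      \<open>x n\<close> for infinitely many \<open>n\<close>, against the third axiom for \<open>y n = x (f n)\<close>.\<close>
    assume "\<not> Cauchy x"
    then obtain \<epsilon> where "\<epsilon> > 0" and far: "\<And>N. \<exists>n\<ge>N. \<exists>m>n. \<epsilon> \<le> dist (x n) (x m)"
      unfolding Cauchy_altdef by (meson not_less)
    have "\<exists>k>n. (\<exists>m>n. \<epsilon> \<le> dist (x n) (x m)) \<longrightarrow> \<epsilon> \<le> dist (x n) (x k)" for n
      by (cases "\<exists>m>n. \<epsilon> \<le> dist (x n) (x m)") auto
    then obtain f where
      f: "\<And>n. f n > n \<and> ((\<exists>m>n. \<epsilon> \<le> dist (x n) (x m)) \<longrightarrow> \<epsilon> \<le> dist (x n) (x (f n)))"
      by metis
    have "(\<lambda>n. \<kappa> (x n) (x (f n))) \<longlonglongrightarrow> 0"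
      by (rule tendsto_sandwich[OF _ _ tendsto_const b_lim])
         (use b_bound f e_distance_nonneg[OF e] in auto)
    then have "(\<lambda>n. dist (x n) (x (f n))) \<longlonglongrightarrow> 0"
      by (intro e_distance_dominated_tails[OF e b_lim] b_bound)
    then have "\<forall>\<^sub>F n in sequentially. dist (x n) (x (f n)) < \<epsilon>"
      using \<open>\<epsilon> > 0\<close> by (rule order_tendstoD)
    then obtain N where "\<And>n. n \<ge> N \<Longrightarrow> dist (x n) (x (f n)) < \<epsilon>"
      unfolding eventually_sequentially by blast
    then show False using far[of N] f by (meson not_less)
  qed
  then obtain v where v: "x \<longlonglongrightarrow> v" using Cauchy_convergent_iff convergent_def by blast
  have "\<kappa> (x n) v \<le> b n" for n
    by (rule e_distance_limit_le[OF e v b0 b_bound])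
  then have "(\<lambda>n. \<kappa> (x n) v) \<longlonglongrightarrow> 0"
    by (intro tendsto_sandwich[OF _ _ tendsto_const b_lim] always_eventually allI
        e_distance_nonneg[OF e])
  then show ?thesis using that v b_lim b_bound by blast
qed

text \<open>The right-hand limit superior controls \<open>\<mu>\<close> only on some interval \<open>(r, c)\<close>; the point \<open>r\<close> itself
  is added by taking the maximum with \<open>\<mu> r\<close>.\<close>

lemma MT_function_bounded_right:
  assumes "MT_function \<mu>" "0 \<le> r"
  obtains c q where "r < c" "0 \<le> q" "q < 1" "\<And>s. r \<le> s \<Longrightarrow> s < c \<Longrightarrow> \<mu> s \<le> q"
proof -
  have "Limsup (at_right r) (\<lambda>s. ereal (\<mu> s)) < 1"
    using assms unfolding MT_function_def by blast
  then obtain l where l: "Limsup (at_right r) (\<lambda>s. ereal (\<mu> s)) < ereal l" "ereal l < 1"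
    using ereal_dense2 by blast
  have "\<forall>\<^sub>F s in at_right r. ereal (\<mu> s) < ereal l"
    using l(1) by (rule Limsup_lessD)
  then obtain c where c: "r < c" "\<And>s. r < s \<Longrightarrow> s < c \<Longrightarrow> \<mu> s < l"
    using eventually_at_right[of r "r + 1"] by auto
  have r: "0 \<le> \<mu> r" "\<mu> r < 1" using assms unfolding MT_function_def by auto
  show ?thesis
  proof (rule that[of c "max (\<mu> r) l"])
    show "max (\<mu> r) l < 1" using r l(2) by (simp add: one_ereal_def)
    show "\<mu> s \<le> max (\<mu> r) l" if "r \<le> s" "s < c" for s
      using c(2)[of s] that by (cases "s = r") auto
  qed (use c r in auto)
qed

text \<open>The terms decrease, so they approach their limit \<open>r\<close> from the right, where \<open>\<mu>\<close> is bounded by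
  some \<open>q < 1\<close>. From then on consecutive terms have ratio at most \<open>(1 + q)/2 < 1\<close>.\<close>

lemma MT_steps_summable:
  assumes MT: "MT_function \<mu>" and t0: "\<And>n. 0 \<le> t n"
    and step: "\<And>n. t (Suc n) \<le> (1 + \<mu> (t n)) / 2 * t n"
  shows "summable t"
proof -
  have "\<mu> (t n) < 1" for n using MT t0 unfolding MT_function_def by blast
  then have "(1 + \<mu> (t n)) / 2 * t n \<le> 1 * t n" for n
    using t0 by (intro mult_right_mono) (auto simp: less_imp_le)
  then have dec: "decseq t"
    using step by (intro decseq_SucI) (metis order_trans mult_1)
  then obtain r where r: "t \<longlonglongrightarrow> r" "\<And>n. r \<le> t n"
    using decseq_convergent[of t 0] t0 by blast
  have "0 \<le> r" using LIMSEQ_le_const[OF r(1)] t0 by blast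
  then obtain c q where c: "r < c" "0 \<le> q" "q < 1" "\<And>s. r \<le> s \<Longrightarrow> s < c \<Longrightarrow> \<mu> s \<le> q"
    using MT_function_bounded_right[OF MT] by blast
  obtain N where N: "\<And>n. n \<ge> N \<Longrightarrow> t n < c"
    using order_tendstoD(2)[OF r(1) c(1)] unfolding eventually_sequentially by blast
  show ?thesis
  proof (rule summable_ratio_test[of "(1 + q) / 2" N])
    fix n assume "n \<ge> N"
    then have "(1 + \<mu> (t n)) / 2 * t n \<le> (1 + q) / 2 * t n"
      using c(4) N r(2) t0 by (intro mult_right_mono) auto
    then show "norm (t (Suc n)) \<le> (1 + q) / 2 * norm (t n)"
      using step[of n] t0 by simp
  qed (use c in simp)
qed

section \<open>Lower semicontinuity along sequences\<close>

lemma lower_semicontinuous_null_sequence: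
  assumes "lower_semicontinuous f" "x \<longlonglongrightarrow> v" "(\<lambda>n. f (x n)) \<longlonglongrightarrow> 0"
  shows "f v \<le> 0"
proof (rule ccontr)
  assume "\<not> f v \<le> 0"
  then have "ereal (f v / 2) < ereal (f v)" by simp
  also have "\<dots> \<le> Liminf (at v) (\<lambda>y. ereal (f y))"
    using assms(1) unfolding lower_semicontinuous_def by blast
  finally have "\<forall>\<^sub>F y in at v. ereal (f v / 2) < ereal (f y)" by (rule less_LiminfD)
  \<comment> \<open>The filter \<open>at v\<close> omits \<open>v\<close>, which the sequence may visit; but the bound holds at \<open>v\<close> too.\<close>
  then have "\<forall>\<^sub>F y in nhds v. f v / 2 < f y"
    unfolding eventually_at_filter
    by eventually_elim (use \<open>\<not> f v \<le> 0\<close> in auto)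
  then have "\<forall>\<^sub>F n in sequentially. f v / 2 < f (x n)"
    using assms(2) unfolding filterlim_iff by blast
  moreover have "\<forall>\<^sub>F n in sequentially. f (x n) < f v / 2"
    using \<open>\<not> f v \<le> 0\<close> by (intro order_tendstoD(2)[OF assms(3)]) simp
  ultimately have "\<forall>\<^sub>F n in sequentially. False" by eventually_elim simp
  then show False by simp
qed

section \<open>The fixed point theorem\<close>

text \<open>With factor \<open>(1 + \<mu>)/2\<close> the gap bound is strict, so the infimum is undercut by a point of
  \<open>T y\<close>, unless \<open>\<kappa> x y = 0\<close>. In that case the gap of \<open>y\<close> vanishes, and \<open>y\<close> itself is the next
  point.\<close>

lemma contractive_next_point:
  assumes e0: "e0_distance \<kappa>" and "C \<noteq> {}" "closed C" "MT_function \<mu>"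
    and gap: "set_gap \<kappa> y C \<le> \<mu> (\<kappa> x y) * \<kappa> x y"
  shows "\<exists>z\<in>C. \<kappa> y z \<le> (1 + \<mu> (\<kappa> x y)) / 2 * \<kappa> x y"
proof (cases "\<kappa> x y = 0")
  case True
  have "0 \<le> set_gap \<kappa> y C"
    using e0 \<open>C \<noteq> {}\<close> by (intro set_gap_nonneg e_distance_nonneg) (auto simp: e0_distance_def)
  then have "y \<in> C"
    using set_gap_zero_imp_mem[OF e0] assms(2,3) gap True by simp
  then show ?thesis using e0 True unfolding e0_distance_def by (intro bexI[of _ y]) simp_all
next
  case False
  then have pos: "0 < \<kappa> x y"
    using e0 e_distance_nonneg unfolding e0_distance_def by (metis order_le_less)
  then have "\<mu> (\<kappa> x y) < 1" using assms(4) unfolding MT_function_def by simp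
  then have "\<mu> (\<kappa> x y) * \<kappa> x y < (1 + \<mu> (\<kappa> x y)) / 2 * \<kappa> x y"
    using pos by (intro mult_strict_right_mono) auto
  then have "set_gap \<kappa> y C < (1 + \<mu> (\<kappa> x y)) / 2 * \<kappa> x y" using gap by simp
  then show ?thesis using set_gap_lessD[OF assms(2)] by (metis less_imp_le)
qed

theorem theorem2p3:
  fixes \<kappa> :: "'a::complete_space \<Rightarrow> 'a \<Rightarrow> real"
    and T :: "'a \<Rightarrow> 'a set"
    and \<phi> :: "'a \<Rightarrow> 'a"
    and \<mu> :: "real \<Rightarrow> real"
    and L :: real
  assumes "e0_distance \<kappa>"
    and "\<And>x. T x \<in> nonempty_closed_sets"
    and "continuous_on UNIV \<phi>"
    and "MT_function \<mu>"
    and "L \<ge> 0"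
    and S2: "closed_multimap T
      \<or> lower_semicontinuous (\<lambda>x. set_gap \<kappa> x (T x))
      \<or> lower_semicontinuous (\<lambda>x. infdist x (T x))
      \<or> (\<forall>(x :: nat \<Rightarrow> 'a) v. (\<forall>n. x (Suc n) \<in> T (x n)) \<and> x \<longlonglongrightarrow> v
            \<longrightarrow> (\<lambda>n. set_gap \<kappa> (x n) (T v)) \<longlonglongrightarrow> 0)
      \<or> (\<forall>z. z \<notin> fixed_point_set T \<longrightarrow> (INF x. \<kappa> x z + set_gap \<kappa> x (T x)) > 0)"
    and S4: "\<And>x. \<phi> ` T x \<subseteq> T x"
    and S5: "\<And>x y. set_gap \<kappa> y (T y) \<le> \<mu> (\<kappa> x y) * \<kappa> x y + L * set_gap \<kappa> (\<phi> y) (T x)"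
  shows "coincidence_set \<phi> T \<inter> fixed_point_set T \<noteq> {}"
proof -
  have e: "e_distance \<kappa>" and diag: "\<And>x. \<kappa> x x = 0"
    using assms(1) unfolding e0_distance_def by auto
  note nonneg = e_distance_nonneg[OF e]
  have ne: "T x \<noteq> {}" and cl: "closed (T x)" for x
    using assms(2)[of x] unfolding nonempty_closed_sets_def by auto
  have contr: "set_gap \<kappa> y (T y) \<le> \<mu> (\<kappa> x y) * \<kappa> x y" if "y \<in> T x" for x y
  proof -
    have "\<phi> y \<in> T x" using S4 that by blast
    then have "set_gap \<kappa> (\<phi> y) (T x) = 0"
      using set_gap_lower[of \<kappa> "\<phi> y" "T x" "\<phi> y"] set_gap_nonneg[of \<kappa> "T x" "\<phi> y"] nonneg ne diag
      by force
    then show ?thesis using S5[of y x] by simp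
  qed

  \<comment> \<open>The recursion runs over pairs of consecutive points, because the bound on the next step
    involves the length of the previous one.\<close>
  have "\<exists>p. \<forall>n. snd (p n) \<in> T (fst (p n)) \<and> fst (p (Suc n)) = snd (p n) \<and>
      \<kappa> (fst (p (Suc n))) (snd (p (Suc n)))
        \<le> (1 + \<mu> (\<kappa> (fst (p n)) (snd (p n)))) / 2 * \<kappa> (fst (p n)) (snd (p n))"
  proof (rule dependent_nat_choice)
    show "\<exists>p. snd p \<in> T (fst p)" using ne by fastforce
    fix p :: "'a \<times> 'a" assume "snd p \<in> T (fst p)"
    then obtain z where "z \<in> T (snd p)"
        "\<kappa> (snd p) z \<le> (1 + \<mu> (\<kappa> (fst p) (snd p))) / 2 * \<kappa> (fst p) (snd p)"
      using contractive_next_point[OF assms(1) ne cl assms(4) contr] by blast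
    then show "\<exists>p'. snd p' \<in> T (fst p') \<and> fst p' = snd p \<and>
        \<kappa> (fst p') (snd p') \<le> (1 + \<mu> (\<kappa> (fst p) (snd p))) / 2 * \<kappa> (fst p) (snd p)"
      by (intro exI[of _ "(snd p, z)"]) simp
  qed
  then obtain p where p: "\<And>n. snd (p n) \<in> T (fst (p n))" "\<And>n. fst (p (Suc n)) = snd (p n)"
      "\<And>n. \<kappa> (fst (p (Suc n))) (snd (p (Suc n)))
        \<le> (1 + \<mu> (\<kappa> (fst (p n)) (snd (p n)))) / 2 * \<kappa> (fst (p n)) (snd (p n))"
    by blast
  define x where "x = (\<lambda>n. fst (p n))"
  have orbit: "x (Suc n) \<in> T (x n)" for n using p by (simp add: x_def)
  have "summable (\<lambda>n. \<kappa> (x n) (x (Suc n)))"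
    using p by (intro MT_steps_summable[OF assms(4)] nonneg) (simp add: x_def)
  then have steps: "(\<lambda>n. \<kappa> (x n) (x (Suc n))) \<longlonglongrightarrow> 0"
    and "summable (\<lambda>n. \<kappa> (x n) (x (Suc n)))" by (auto dest: summable_LIMSEQ_zero)
  then obtain v b where v: "x \<longlonglongrightarrow> v" and b: "b \<longlonglongrightarrow> 0" "\<And>n m. n < m \<Longrightarrow> \<kappa> (x n) (x m) \<le> b n"
    and to_v: "(\<lambda>n. \<kappa> (x n) v) \<longlonglongrightarrow> 0"
    using e_distance_summable_steps[OF e] by blast
  have v': "(\<lambda>n. x (Suc n)) \<longlonglongrightarrow> v" using v by (rule LIMSEQ_Suc)
  have gaps: "(\<lambda>n. set_gap \<kappa> (x n) (T (x n))) \<longlonglongrightarrow> 0"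
    by (rule tendsto_sandwich[OF _ _ tendsto_const steps])
       (use set_gap_nonneg[of \<kappa>] set_gap_lower[of \<kappa>] nonneg ne orbit in auto)

  consider (closed_graph) "closed_multimap T"
    | (lsc_gap) "lower_semicontinuous (\<lambda>x. set_gap \<kappa> x (T x))"
    | (lsc_dist) "lower_semicontinuous (\<lambda>x. infdist x (T x))"
    | (gap_limit) "(\<lambda>n. set_gap \<kappa> (x n) (T v)) \<longlonglongrightarrow> 0"
    | (separation) "\<forall>z. z \<notin> fixed_point_set T \<longrightarrow> (INF x. \<kappa> x z + set_gap \<kappa> x (T x)) > 0"
    using S2 orbit v by blast
  then have "v \<in> T v"
  proof cases
    case closed_graph
    then have "(v, v) \<in> {(x, y). y \<in> T x}"
      using closed_sequentially[of _ "\<lambda>n. (x n, x (Suc n))"] tendsto_Pair[OF v v'] orbit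
      unfolding closed_multimap_def by blast
    then show ?thesis by simp
  next
    case lsc_gap
    then have "set_gap \<kappa> v (T v) \<le> 0"
      using lower_semicontinuous_null_sequence[OF _ v gaps] by blast
    then have "set_gap \<kappa> v (T v) = 0"
      using set_gap_nonneg[of \<kappa> "T v" v] nonneg ne by force
    then show ?thesis using set_gap_zero_imp_mem[OF assms(1) ne cl] by blast
  next
    case lsc_dist
    have dists: "(\<lambda>n. dist (x n) (x (Suc n))) \<longlonglongrightarrow> 0" using tendsto_dist[OF v v'] by simp
    have "(\<lambda>n. infdist (x n) (T (x n))) \<longlonglongrightarrow> 0"
      by (rule tendsto_sandwich[OF _ _ tendsto_const dists])
         (intro always_eventually allI infdist_nonneg infdist_le orbit)+
    then have "infdist v (T v) \<le> 0"
      using lower_semicontinuous_null_sequence[OF lsc_dist v] by blast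
    then show ?thesis
      using in_closed_iff_infdist_zero[OF cl ne] infdist_nonneg[of v "T v"] by force
  next
    case gap_limit
    then show ?thesis using limit_mem_of_vanishing_gaps[OF e ne cl v b] by blast
  next
    case separation
    show ?thesis
    proof (rule ccontr)
      assume "v \<notin> T v"
      then have pos: "(INF x. \<kappa> x v + set_gap \<kappa> x (T x)) > 0"
        using separation unfolding fixed_point_set_def by simp
      have "(INF x. \<kappa> x v + set_gap \<kappa> x (T x)) \<le> \<kappa> (x n) v + set_gap \<kappa> (x n) (T (x n))" for n
        by (rule cINF_lower)
           (auto intro!: bdd_belowI[where m = 0] add_nonneg_nonneg set_gap_nonneg nonneg ne)
      then have "(INF x. \<kappa> x v + set_gap \<kappa> x (T x)) \<le> 0"
        using LIMSEQ_le_const[OF tendsto_add[OF to_v gaps]] by fastforce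
      then show False using pos by simp
    qed
  qed
  moreover from this have "\<phi> v \<in> T v" using S4 by blast
  ultimately show ?thesis unfolding coincidence_set_def fixed_point_set_def by blast
qed

end
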